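(* Let $n\ge2$ and let $K=K(n,\Lambda)\subset\mathbb{R}^2$ be a generalized Sierpiński carpet satisfying the strong separation condition. Let $\theta\in\mathbb{R}$ and let $R_\theta$ be the counterclockwise rotation of $\mathbb{R}^2$ about the origin by angle $\theta$. If $f(x)=\lambda R_\theta x+a$ (with $a\in\mathbb{R}^2$) is an oblique similitude with $f(K)\subset K$, then $|\tan\theta|=1$.
   Context: Generalized Sierpiński carpet: let $n\ge2$ be an integer and $\Lambda\subset\{0,\dots,n-1\}^2$ with $1<\#\Lambda<n^2$ (this cardinality condition is always assumed). Put $\varphi_{i,j}(x,y)=\left(\frac{x+i}{n},\frac{y+j}{n}\right)$ for $(i,j)\in\Lambda$. Then $K(n,\Lambda)$ is the attractor of $\{\varphi_{i,j}\}_{(i,j)\in\Lambda}$, i.e. $K(n,\Lambda)=\left\{\sum_{k\ge1} n^{-k}(i_k,j_k):(i_k,j_k)\in\Lambda\text{ for all }k\right\}$. Strong separation condition: the sets $\varphi_{i,j}(K)$, $(i,j)\in\Lambda$, are pairwise disjoint. Obliqueness: a line in $\mathbb{R}^2$ is oblique if it is not parallel to either coordinate axis. A similitude $f$ of $\mathbb{R}^2$ with positive similarity ratio ($\lambda>0$) is oblique if $f$ sends the $x$-axis to an oblique line. *)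

theory Defs
  imports "HOL-Analysis.Analysis"
begin

fun carpet_map :: "nat \<Rightarrow> nat \<times> nat \<Rightarrow> real \<times> real \<Rightarrow> real \<times> real" where
  "carpet_map n (i, j) (x, y) = ((x + real i) / real n, (y + real j) / real n)"

text \<open>Digit sequences are indexed from 0, hence the exponent \<open>k + 1\<close>.\<close>

definition carpet :: "nat \<Rightarrow> (nat \<times> nat) set \<Rightarrow> (real \<times> real) set" where
  "carpet n \<Lambda> =
     {\<Sum>k. (1 / real n ^ (k + 1)) *\<^sub>R (real (fst (d k)), real (snd (d k))) | d. \<forall>k. d k \<in> \<Lambda>}"

definition strong_separation :: "nat \<Rightarrow> (nat \<times> nat) set \<Rightarrow> bool" where
  "strong_separation n \<Lambda> \<longleftrightarrow> disjoint_family_on (\<lambda>d. carpet_map n d ` carpet n \<Lambda>) \<Lambda>"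

definition x_axis :: "(real \<times> real) set" where "x_axis = {(x, y). y = 0}"
definition y_axis :: "(real \<times> real) set" where "y_axis = {(x, y). x = 0}"

definition oblique_line :: "(real \<times> real) set \<Rightarrow> bool" where
  "oblique_line L \<longleftrightarrow> affine L \<and> aff_dim L = 1 \<and>
     \<not> affine_parallel L x_axis \<and> \<not> affine_parallel L y_axis"

definition similitude :: "real \<Rightarrow> (real \<times> real \<Rightarrow> real \<times> real) \<Rightarrow> bool" where
  "similitude r f \<longleftrightarrow> 0 < r \<and> (\<forall>p q. dist (f p) (f q) = r * dist p q)"

definition oblique_similitude :: "(real \<times> real \<Rightarrow> real \<times> real) \<Rightarrow> bool" where
  "oblique_similitude f \<longleftrightarrow> (\<exists>r. similitude r f) \<and> oblique_line (f ` x_axis)"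

fun rotation :: "real \<Rightarrow> real \<times> real \<Rightarrow> real \<times> real" where
  "rotation \<theta> (x, y) = (cos \<theta> * x - sin \<theta> * y, sin \<theta> * x + cos \<theta> * y)"


text \<open>The rest of this theory shows that \<open>carpet n \<Lambda>\<close> is the attractor of the maps
  \<open>carpet_map n d\<close> with \<open>d \<in> \<Lambda>\<close>: the unique nonempty compact set that is the union of its
  images under them.\<close>

lemma carpetI:
  assumes "\<And>k. d k \<in> \<Lambda>"
  shows "(\<Sum>k. (1 / real n ^ (k + 1)) *\<^sub>R (real (fst (d k)), real (snd (d k)))) \<in> carpet n \<Lambda>"
  unfolding carpet_def mem_Collect_eq by (intro exI[of _ d] conjI refl allI assms)

lemma carpetE:
  assumes "z \<in> carpet n \<Lambda>"
  obtains d where "\<forall>k. d k \<in> \<Lambda>"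
    and "z = (\<Sum>k. (1 / real n ^ (k + 1)) *\<^sub>R (real (fst (d k)), real (snd (d k))))"
  using assms unfolding carpet_def mem_Collect_eq by (elim exE conjE)

lemma carpet_map_eq:
  "carpet_map n d p = (1 / real n) *\<^sub>R (p + (real (fst d), real (snd d)))"
  by (cases d; cases p) auto

lemma carpet_map_iterate:
  assumes "\<And>k. xs k = carpet_map n (d k) (xs (Suc k))"
  shows "xs 0 = (\<Sum>k<N. (1 / real n ^ (k + 1)) *\<^sub>R (real (fst (d k)), real (snd (d k))))
           + (1 / real n ^ N) *\<^sub>R xs N"
proof (induction N)
  case 0
  show ?case by simp
next
  case (Suc N)
  have "(1 / real n ^ N) *\<^sub>R xs N = (1 / real n ^ (N + 1)) *\<^sub>R (real (fst (d N)), real (snd (d N)))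
      + (1 / real n ^ Suc N) *\<^sub>R xs (Suc N)"
    by (subst assms[of N], unfold carpet_map_eq)
       (simp add: scaleR_add_right scaleR_conv_of_real mult_ac del: scaleR_Pair)
  with Suc.IH show ?case by simp
qed

lemma scaled_null:
  fixes xs :: "nat \<Rightarrow> real \<times> real"
  assumes "n \<ge> 2" and "\<And>N. norm (xs N) \<le> B"
  shows "(\<lambda>N. (1 / real n ^ N) *\<^sub>R xs N) \<longlonglongrightarrow> 0"
proof (rule Lim_null_comparison)
  show "\<forall>\<^sub>F N in sequentially. norm ((1 / real n ^ N) *\<^sub>R xs N) \<le> (1 / real n) ^ N * B"
    using assms by (intro always_eventually allI)
      (auto simp: power_one_over divide_right_mono)
  have "(\<lambda>N. (1 / real n) ^ N) \<longlonglongrightarrow> 0"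
    using assms(1) by (intro LIMSEQ_power_zero) auto
  then show "(\<lambda>N. (1 / real n) ^ N * B) \<longlonglongrightarrow> 0"
    by (rule tendsto_mult_left_zero)
qed

lemma carpet_summable:
  assumes "n \<ge> 2" "\<Lambda> \<subseteq> {0..<n} \<times> {0..<n}" "\<forall>k. d k \<in> \<Lambda>"
  shows "summable (\<lambda>k. (1 / real n ^ (k + 1)) *\<^sub>R (real (fst (d k)), real (snd (d k))))"
proof (rule summable_comparison_test')
  show "summable (\<lambda>k. (1 / real n) ^ k * 2)"
    using assms(1) by (intro summable_mult2 summable_geometric) auto
  fix k :: nat
  have "d k \<in> {0..<n} \<times> {0..<n}" using assms by blast
  then have b: "real (fst (d k)) \<le> real n" "real (snd (d k)) \<le> real n" by auto
  have "norm (real (fst (d k)), real (snd (d k))) \<le> real n + real n"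
    using norm_Pair_le[of "real (fst (d k))" "real (snd (d k))"] b by simp
  then have "(1 / real n ^ (k + 1)) * norm (real (fst (d k)), real (snd (d k)))
      \<le> (1 / real n ^ (k + 1)) * (real n + real n)"
    by (intro mult_left_mono) auto
  also have "\<dots> = (1 / real n) ^ k * 2" using assms(1) by (simp add: field_simps)
  finally show "norm ((1 / real n ^ (k + 1)) *\<^sub>R (real (fst (d k)), real (snd (d k))))
      \<le> (1 / real n) ^ k * 2" by (simp del: scaleR_Pair)
qed

lemma carpet_bounded:
  assumes "n \<ge> 2" "\<Lambda> \<subseteq> {0..<n} \<times> {0..<n}"
  shows "bounded (carpet n \<Lambda>)"
proof -
  have "norm x \<le> (\<Sum>k. (1 / real n) ^ k * 2)" if "x \<in> carpet n \<Lambda>" for x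
  proof -
    obtain d where d: "\<forall>k. d k \<in> \<Lambda>"
      and x: "x = (\<Sum>k. (1 / real n ^ (k + 1)) *\<^sub>R (real (fst (d k)), real (snd (d k))))"
      using \<open>x \<in> carpet n \<Lambda>\<close> unfolding carpet_def by blast
    show ?thesis unfolding x
    proof (rule norm_suminf_le)
      show "summable (\<lambda>k. (1 / real n) ^ k * 2)"
        using assms(1) by (intro summable_mult2 summable_geometric) auto
      fix k :: nat
      have "d k \<in> {0..<n} \<times> {0..<n}" using assms d by blast
      then have b: "real (fst (d k)) \<le> real n" "real (snd (d k)) \<le> real n" by auto
      have "norm (real (fst (d k)), real (snd (d k))) \<le> real n + real n"
        using norm_Pair_le[of "real (fst (d k))" "real (snd (d k))"] b by simp
      then have "(1 / real n ^ (k + 1)) * norm (real (fst (d k)), real (snd (d k)))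
          \<le> (1 / real n ^ (k + 1)) * (real n + real n)"
        by (intro mult_left_mono) auto
      also have "\<dots> = (1 / real n) ^ k * 2" using assms(1) by (simp add: field_simps)
      finally show "norm ((1 / real n ^ (k + 1)) *\<^sub>R (real (fst (d k)), real (snd (d k))))
          \<le> (1 / real n) ^ k * 2" by (simp del: scaleR_Pair)
    qed
  qed
  then show ?thesis unfolding bounded_iff by blast
qed

lemma subset_carpet:
  assumes "n \<ge> 2" "\<Lambda> \<subseteq> {0..<n} \<times> {0..<n}"
    and "bounded X" "X \<subseteq> (\<Union>d\<in>\<Lambda>. carpet_map n d ` X)"
  shows "X \<subseteq> carpet n \<Lambda>"
proof
  fix x assume "x \<in> X"
  have "\<forall>x\<in>X. \<exists>d y. d \<in> \<Lambda> \<and> y \<in> X \<and> x = carpet_map n d y" using assms(4) by blast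
  then obtain g h where gh: "\<And>x. x \<in> X \<Longrightarrow> g x \<in> \<Lambda> \<and> h x \<in> X \<and> x = carpet_map n (g x) (h x)"
    by metis
  define xs where "xs = (\<lambda>k. (h ^^ k) x)"
  have x0: "xs 0 = x" by (simp add: xs_def)
  have xsX: "xs k \<in> X" for k
    by (induction k) (use gh \<open>x \<in> X\<close> in \<open>auto simp: xs_def\<close>)
  define d where "d = (\<lambda>k. g (xs k))"
  have dL: "\<forall>k. d k \<in> \<Lambda>" using gh xsX by (simp add: d_def)
  have step: "xs k = carpet_map n (d k) (xs (Suc k))" for k
    using gh[OF xsX[of k]] by (simp add: d_def xs_def)
  obtain B where "\<And>y. y \<in> X \<Longrightarrow> norm y \<le> B" using assms(3) by (auto simp: bounded_iff)
  then have null: "(\<lambda>N. (1 / real n ^ N) *\<^sub>R xs N) \<longlonglongrightarrow> 0"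
    using scaled_null[OF assms(1)] xsX by blast
  have "(\<Sum>k<N. (1 / real n ^ (k + 1)) *\<^sub>R (real (fst (d k)), real (snd (d k))))
      = x - (1 / real n ^ N) *\<^sub>R xs N" for N
    using carpet_map_iterate[of xs n d N, OF step] x0 by (simp add: eq_diff_eq del: scaleR_Pair)
  moreover have "(\<lambda>N. x - (1 / real n ^ N) *\<^sub>R xs N) \<longlonglongrightarrow> x - 0"
    by (intro tendsto_diff null tendsto_const)
  ultimately have "(\<lambda>k. (1 / real n ^ (k + 1)) *\<^sub>R (real (fst (d k)), real (snd (d k)))) sums x"
    by (simp add: sums_def del: scaleR_Pair)
  then show "x \<in> carpet n \<Lambda>"
    unfolding carpet_def using dL sums_unique by blast
qed

lemma carpet_subset:
  assumes "n \<ge> 2" "\<Lambda> \<subseteq> {0..<n} \<times> {0..<n}"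
    and "closed X" "X \<noteq> {}" "(\<Union>d\<in>\<Lambda>. carpet_map n d ` X) \<subseteq> X"
  shows "carpet n \<Lambda> \<subseteq> X"
proof
  fix z assume "z \<in> carpet n \<Lambda>"
  then obtain d where d: "\<forall>k. d k \<in> \<Lambda>"
    and z: "z = (\<Sum>k. (1 / real n ^ (k + 1)) *\<^sub>R (real (fst (d k)), real (snd (d k))))"
    unfolding carpet_def by blast
  obtain x where x: "x \<in> X" using assms(4) by blast
  let ?t = "\<lambda>k. (1 / real n ^ (k + 1)) *\<^sub>R (real (fst (d k)), real (snd (d k)))"
  have inX: "(\<Sum>k<N. ?t k) + (1 / real n ^ N) *\<^sub>R y \<in> X" if "y \<in> X" for N y
    using that
  proof (induction N arbitrary: y)
    case 0
    then show ?case by simp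
  next
    case (Suc N)
    have "carpet_map n (d N) y \<in> X" using Suc.prems d assms(5) by blast
    from Suc.IH[OF this] show ?case
      by (simp add: carpet_map_eq scaleR_add_right mult_ac add_ac del: scaleR_Pair)
  qed
  have "(\<lambda>N. (\<Sum>k<N. ?t k) + (1 / real n ^ N) *\<^sub>R x) \<longlonglongrightarrow> z + 0"
    unfolding z
    by (intro tendsto_add summable_LIMSEQ carpet_summable[OF assms(1,2) d]
          scaled_null[OF assms(1), of "\<lambda>_. x" "norm x"]) simp
  then have "z + 0 \<in> X"
    by (rule closed_sequentially[OF assms(3) inX[OF x]])
  then show "z \<in> X" by simp
qed

lemma carpet_invariant:
  assumes "n \<ge> 2" "\<Lambda> \<subseteq> {0..<n} \<times> {0..<n}"
  shows "carpet n \<Lambda> = (\<Union>d\<in>\<Lambda>. carpet_map n d ` carpet n \<Lambda>)" (is "?K = ?U")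
proof -
  let ?t = "\<lambda>d k. (1 / real n ^ (k + 1)) *\<^sub>R (real (fst (d k)), real (snd (d k)))"
  have shift: "(\<Sum>k. ?t d k) = carpet_map n (d 0) (\<Sum>k. ?t (\<lambda>k. d (Suc k)) k)"
    if d: "\<forall>k. d k \<in> \<Lambda>" for d
  proof -
    have split: "u = v + (u - v)" for u v :: "real \<times> real" by simp
    have s: "summable (?t d)"
      by (rule carpet_summable[OF assms d])
    have s': "summable (?t (\<lambda>k. d (Suc k)))"
      by (rule carpet_summable[OF assms, of "\<lambda>k. d (Suc k)"]) (simp add: d)
    have "(\<Sum>k. ?t d k) = ?t d 0 + (\<Sum>k. ?t d (Suc k))"
      unfolding suminf_split_head[OF s] by (rule split)
    also have "(\<Sum>k. ?t d (Suc k)) = (\<Sum>k. (1 / real n) *\<^sub>R ?t (\<lambda>k. d (Suc k)) k)"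
      by (intro suminf_cong) simp
    also have "\<dots> = (1 / real n) *\<^sub>R (\<Sum>k. ?t (\<lambda>k. d (Suc k)) k)"
      using s' by (rule suminf_scaleR_right[symmetric])
    also have "?t d 0 + \<dots> = carpet_map n (d 0) (\<Sum>k. ?t (\<lambda>k. d (Suc k)) k)"
      unfolding carpet_map_eq scaleR_add_right add_0 power_one_right by (rule add.commute)
    finally show ?thesis .
  qed
  show ?thesis
  proof
    show "?K \<subseteq> ?U"
    proof
      fix z assume "z \<in> ?K"
      then obtain d where d: "\<forall>k. d k \<in> \<Lambda>" and z: "z = (\<Sum>k. ?t d k)"
        by (rule carpetE)
      have "(\<Sum>k. ?t (\<lambda>k. d (Suc k)) k) \<in> ?K"
        by (rule carpetI[of "\<lambda>k. d (Suc k)"]) (simp add: d)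
      moreover have "z = carpet_map n (d 0) (\<Sum>k. ?t (\<lambda>k. d (Suc k)) k)"
        unfolding z by (rule shift[OF d])
      ultimately show "z \<in> ?U" using d by (intro UN_I[of "d 0"]) (simp, rule image_eqI)
    qed
    show "?U \<subseteq> ?K"
    proof
      fix z assume "z \<in> ?U"
      then obtain e y where e: "e \<in> \<Lambda>" and y: "y \<in> ?K" and zy: "z = carpet_map n e y"
        by blast
      from y obtain d where d: "\<forall>k. d k \<in> \<Lambda>" and "y = (\<Sum>k. ?t d k)"
        by (rule carpetE)
      with zy have z: "z = carpet_map n e (\<Sum>k. ?t d k)" by (simp only:)
      define d' where "d' = case_nat e d"
      have d': "\<forall>k. d' k \<in> \<Lambda>" using e d by (auto simp: d'_def split: nat.split)
      have "z = (\<Sum>k. ?t d' k)"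
        unfolding z by (subst shift[OF d']) (simp only: d'_def nat.case)
      then show "z \<in> ?K" using carpetI[of d' \<Lambda> n] d' by metis
    qed
  qed
qed

lemma carpet_compact:
  assumes "n \<ge> 2" "\<Lambda> \<subseteq> {0..<n} \<times> {0..<n}"
  shows "compact (carpet n \<Lambda>)"
proof -
  let ?C = "closure (carpet n \<Lambda>)"
  have fin: "finite \<Lambda>" using assms(2) finite_subset by blast
  have C: "compact ?C" using carpet_bounded[OF assms] by simp
  have cont: "continuous_on ?C (carpet_map n d)" for d
    unfolding carpet_map_eq[abs_def] by (intro continuous_intros)
  have "compact (\<Union>d\<in>\<Lambda>. carpet_map n d ` ?C)"
    by (intro compact_UN fin compact_continuous_image cont C)
  moreover have "carpet n \<Lambda> \<subseteq> (\<Union>d\<in>\<Lambda>. carpet_map n d ` ?C)"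
    using carpet_invariant[OF assms] closure_subset by blast
  ultimately have "?C \<subseteq> (\<Union>d\<in>\<Lambda>. carpet_map n d ` ?C)"
    by (intro closure_minimal compact_imp_closed)
  then have "?C \<subseteq> carpet n \<Lambda>"
    using subset_carpet[OF assms] C compact_imp_bounded by blast
  then have "?C = carpet n \<Lambda>" using closure_subset by blast
  then show ?thesis using C by simp
qed

theorem carpet_is_attractor:
  assumes "n \<ge> 2" "\<Lambda> \<subseteq> {0..<n} \<times> {0..<n}" "\<Lambda> \<noteq> {}"
  shows "compact X \<and> X \<noteq> {} \<and> X = (\<Union>d\<in>\<Lambda>. carpet_map n d ` X) \<longleftrightarrow> X = carpet n \<Lambda>"
proof
  assume X: "compact X \<and> X \<noteq> {} \<and> X = (\<Union>d\<in>\<Lambda>. carpet_map n d ` X)"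
  then show "X = carpet n \<Lambda>"
    by (intro equalityI subset_carpet[OF assms(1,2)] carpet_subset[OF assms(1,2)])
       (auto simp: compact_imp_bounded compact_imp_closed)
next
  obtain e where "e \<in> \<Lambda>" using assms(3) by blast
  then have "carpet n \<Lambda> \<noteq> {}" using carpetI[of "\<lambda>_. e" \<Lambda> n] by (metis empty_iff)
  moreover assume "X = carpet n \<Lambda>"
  ultimately show "compact X \<and> X \<noteq> {} \<and> X = (\<Union>d\<in>\<Lambda>. carpet_map n d ` X)"
    using carpet_compact[OF assms(1,2)] carpet_invariant[OF assms(1,2)] by simp
qed

end

theory Submission
  imports Defs
begin

text \<open>The outer normals of the edges of the convex hull of the carpet \<open>K\<close> are the normals of the edges of
  the convex hull of the digit set \<open>\<Lambda>\<close> (\<open>edge_normals_carpet\<close>). They are perpendicular to differences of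
  digits, so up to scaling they are among finitely many integer vectors. The proof shows that rotation by \<open>\<theta>\<close>
  maps these normals to each other (\<open>rotation_edge_normals\<close>). Then all multiples of \<open>\<theta>\<close> are angles
  between integer vectors of bounded length, and an argument in the style of Niven's theorem leaves only
  multiples of \<open>\<pi> / 4\<close> (\<open>tan_one_if_rational_multiples\<close>); obliqueness excludes multiples of \<open>\<pi> / 2\<close>.

  The invariance of the normals would be clear if \<open>K\<close> were a finite union of translates of one scaled
  and rotated copy of itself: the translate that reaches furthest in a rotated normal direction
  has its edge with this normal on the boundary of the hull. The inclusion \<open>f ` K \<subseteq> K\<close> gives this because
  \<open>f ` K\<close> contains a cylinder of \<open>K\<close> (\<open>cyl_covered_by_image\<close>). By strong separation there is a constant
  \<open>c\<close> such that \<open>f\<close> maps each cylinder of depth \<open>k + c\<close> into one of depth \<open>k\<close>. For a word \<open>u\<close>, the number of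
  cylinders of depth \<open>length u + c\<close> that \<open>f\<close> maps into the cylinder of \<open>u\<close> is bounded independently of
  \<open>u\<close>, and it is the average of the corresponding numbers for the children of \<open>u\<close>. It is an integer, so
  it attains its maximum, and below a maximum it is constant and positive. Hence \<open>f ` K\<close> meets every
  cylinder below such a \<open>u\<close>, and by compactness it contains the whole cylinder of \<open>u\<close>.\<close>

section \<open>Cylinders of a separated carpet\<close>

locale separated_carpet =
  fixes n :: nat and \<Lambda> :: "(nat \<times> nat) set"
  assumes n_ge_2: "n \<ge> 2" and digits: "\<Lambda> \<subseteq> {0..<n} \<times> {0..<n}" and nonempty: "\<Lambda> \<noteq> {}"
    and separated: "strong_separation n \<Lambda>"
begin

abbreviation "K \<equiv> carpet n \<Lambda>"
abbreviation "\<phi> \<equiv> foldr (carpet_map n)"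
abbreviation "cyl w \<equiv> \<phi> w ` K"
abbreviation "words k \<equiv> {w. set w \<subseteq> \<Lambda> \<and> length w = k}"

lemma n_pos: "real n > 0" "real n \<ge> 1" using n_ge_2 by auto

lemma finite_digits: "finite \<Lambda>" using digits finite_subset by blast

lemma finite_words: "finite (words k)" using finite_lists_length_eq[OF finite_digits] .

lemma card_words: "card (words k) = card \<Lambda> ^ k" using card_lists_length_eq[OF finite_digits] .

lemma words_split:
  assumes "w \<in> words (j + k)"
  obtains w1 w2 where "w = w1 @ w2" "w1 \<in> words j" "w2 \<in> words k"
proof -
  have "set (take j w) \<subseteq> \<Lambda>" "set (drop j w) \<subseteq> \<Lambda>"
    using assms set_take_subset[of j w] set_drop_subset[of j w] by blast+
  then show ?thesis using that[of "take j w" "drop j w"] assms by simp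
qed

lemma word_map_affine: "\<phi> w p = (1 / real n ^ length w) *\<^sub>R p + \<phi> w 0"
proof (induction w)
  case (Cons d w)
  then show ?case
    by (simp add: carpet_map_eq scaleR_add_right del: scaleR_Pair)
qed simp

lemma dist_word_map: "dist (\<phi> w p) (\<phi> w q) = dist p q / real n ^ length w"
  using n_pos by (subst (1 2) word_map_affine) (simp add: dist_norm flip: scaleR_diff_right)

lemma inj_word_map: "\<phi> w p = \<phi> w q \<longleftrightarrow> p = q"
  using dist_word_map[of w p q] n_pos by (metis dist_eq_0_iff divide_eq_0_iff less_irrefl power_not_zero)

lemma carpet_ne: "K \<noteq> {}"
proof -
  obtain e where "e \<in> \<Lambda>" using nonempty by blast
  then have "carpet n \<Lambda> \<noteq> {}" using carpetI[of "\<lambda>_. e" \<Lambda> n] by (metis empty_iff)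
  then show ?thesis .
qed

lemma map_in: "d \<in> \<Lambda> \<Longrightarrow> x \<in> K \<Longrightarrow> carpet_map n d x \<in> K"
  using carpet_invariant[OF n_ge_2 digits] by blast

lemma mapE:
  assumes "x \<in> K" obtains d y where "d \<in> \<Lambda>" "y \<in> K" "x = carpet_map n d y"
  using carpet_invariant[OF n_ge_2 digits] assms by blast

lemma cyl_Cons: "cyl (d # w) = carpet_map n d ` cyl w"
  by (simp add: image_comp)

lemma cyl_subset: "set w \<subseteq> \<Lambda> \<Longrightarrow> cyl w \<subseteq> K"
proof (induction w)
  case (Cons d w)
  then have "d \<in> \<Lambda>" "cyl w \<subseteq> K" by auto
  then show ?case unfolding cyl_Cons using map_in by blast
qed simp

lemma cyl_append: "set v \<subseteq> \<Lambda> \<Longrightarrow> cyl (w @ v) \<subseteq> cyl w"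
  using cyl_subset[of v] by auto

lemma cyl_appendD: "x \<in> cyl (w @ v) \<Longrightarrow> set v \<subseteq> \<Lambda> \<Longrightarrow> x \<in> cyl w"
  using cyl_append by (rule subsetD)

lemma cyl_cover: "x \<in> K \<Longrightarrow> \<exists>w\<in>words k. x \<in> cyl w"
proof (induction k arbitrary: x)
  case (Suc k)
  obtain d y where d: "d \<in> \<Lambda>" "y \<in> K" "x = carpet_map n d y" using Suc.prems by (rule mapE)
  obtain w where "w \<in> words k" "y \<in> cyl w" using Suc.IH d(2) by blast
  then show ?case using d by (intro bexI[of _ "d # w"]) auto
qed auto

lemma digit_unique:
  assumes "d \<in> \<Lambda>" "e \<in> \<Lambda>" "x \<in> K" "y \<in> K" "carpet_map n d x = carpet_map n e y"
  shows "d = e"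
proof (rule ccontr)
  assume "d \<noteq> e"
  then have "carpet_map n d ` K \<inter> carpet_map n e ` K = {}"
    using separated assms(1,2) unfolding strong_separation_def disjoint_family_on_def by blast
  then show False using assms(3-5) by (metis disjoint_iff imageI)
qed

lemma cyl_unique:
  assumes "v \<in> words k" "w \<in> words k" "x \<in> cyl v" "x \<in> cyl w" shows "v = w"
  using assms
proof (induction k arbitrary: v w x)
  case (Suc k)
  obtain d v' where v: "v = d # v'" "d \<in> \<Lambda>" "v' \<in> words k"
    using Suc.prems(1) by (cases v) auto
  obtain e w' where w: "w = e # w'" "e \<in> \<Lambda>" "w' \<in> words k"
    using Suc.prems(2) by (cases w) auto
  obtain p where p: "p \<in> K" "x = carpet_map n d (\<phi> v' p)" using Suc.prems(3) v by auto
  obtain q where q: "q \<in> K" "x = carpet_map n e (\<phi> w' q)" using Suc.prems(4) w by auto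
  have pq: "\<phi> v' p \<in> K" "\<phi> w' q \<in> K" using cyl_subset v w p q by blast+
  have "d = e" using digit_unique[OF v(2) w(2) pq] p q by simp
  then have "\<phi> v' p = \<phi> w' q" using p q inj_word_map[of "[d]"] by simp
  then show ?case using Suc.IH[OF v(3) w(3)] p q v w \<open>d = e\<close> by (metis imageI)
qed auto

text \<open>Finitely many pairwise disjoint compact pieces have a positive mutual distance; this is the only
  form in which strong separation enters metrically.\<close>
lemma digit_gap:
  obtains \<delta> where "\<delta> > 0"
    "\<And>d e x y. d \<in> \<Lambda> \<Longrightarrow> e \<in> \<Lambda> \<Longrightarrow> x \<in> K \<Longrightarrow> y \<in> K
      \<Longrightarrow> dist (carpet_map n d x) (carpet_map n e y) < \<delta> \<Longrightarrow> d = e"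
proof -
  have comp: "compact (carpet_map n d ` K)" for d
    unfolding carpet_map_eq[abs_def]
    by (intro compact_continuous_image continuous_intros carpet_compact[OF n_ge_2 digits])
  have "\<exists>g>0. \<forall>x\<in>carpet_map n d ` K. \<forall>y\<in>carpet_map n e ` K. g \<le> dist x y"
    if "d \<in> \<Lambda>" "e \<in> \<Lambda>" "d \<noteq> e" for d e
  proof (rule separate_compact_closed[OF comp compact_imp_closed[OF comp]])
    show "carpet_map n d ` K \<inter> carpet_map n e ` K = {}"
      using separated that unfolding strong_separation_def disjoint_family_on_def by blast
  qed
  then obtain g where g: "\<And>d e. d \<in> \<Lambda> \<Longrightarrow> e \<in> \<Lambda> \<Longrightarrow> d \<noteq> e \<Longrightarrow> g d e > (0::real) \<and>
      (\<forall>x\<in>carpet_map n d ` K. \<forall>y\<in>carpet_map n e ` K. g d e \<le> dist x y)"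
    by metis
  let ?G = "insert 1 ((\<lambda>(d, e). g d e) ` {(d, e) \<in> \<Lambda> \<times> \<Lambda>. d \<noteq> e})"
  have fin: "finite ?G"
    using finite_digits by (intro finite.insertI finite_imageI) (rule finite_subset[of _ "\<Lambda> \<times> \<Lambda>"], auto)
  show ?thesis
  proof (rule that[of "Min ?G"])
    show "Min ?G > 0" using fin g by (subst Min_gr_iff) auto
    fix d e x y
    assume *: "d \<in> \<Lambda>" "e \<in> \<Lambda>" "x \<in> K" "y \<in> K" "dist (carpet_map n d x) (carpet_map n e y) < Min ?G"
    show "d = e"
    proof (rule ccontr)
      assume "d \<noteq> e"
      then have "Min ?G \<le> g d e" using * fin by (intro Min_le) auto
      also have "g d e \<le> dist (carpet_map n d x) (carpet_map n e y)" using g * \<open>d \<noteq> e\<close> by blast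
      finally show False using * by simp
    qed
  qed
qed

text \<open>A subset of the carpet of diameter below the gap lies in one piece; blowing that piece up by the
  factor \<open>n\<close> and repeating the argument gives a cylinder of depth comparable to the logarithm of
  the diameter.\<close>
lemma small_sets_in_cylinders:
  obtains \<delta> where "\<delta> > 0"
    "\<And>k E. E \<subseteq> K \<Longrightarrow> E \<noteq> {} \<Longrightarrow>
      (\<And>x y. x \<in> E \<Longrightarrow> y \<in> E \<Longrightarrow> dist x y < \<delta> / real n ^ k) \<Longrightarrow> \<exists>w\<in>words k. E \<subseteq> cyl w"
proof -
  obtain \<delta> where \<delta>: "\<delta> > 0" and sep: "\<And>d e x y. d \<in> \<Lambda> \<Longrightarrow> e \<in> \<Lambda> \<Longrightarrow> x \<in> K \<Longrightarrow> y \<in> K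
      \<Longrightarrow> dist (carpet_map n d x) (carpet_map n e y) < \<delta> \<Longrightarrow> d = e" by (rule digit_gap) blast
  have "\<exists>w\<in>words k. E \<subseteq> cyl w"
    if "E \<subseteq> K" "E \<noteq> {}" "\<And>x y. x \<in> E \<Longrightarrow> y \<in> E \<Longrightarrow> dist x y < \<delta> / real n ^ k" for k E
    using that
  proof (induction k arbitrary: E)
    case (Suc k)
    obtain x0 where x0: "x0 \<in> E" using Suc.prems by blast
    then obtain d y0 where d: "d \<in> \<Lambda>" "y0 \<in> K" "x0 = carpet_map n d y0" using Suc.prems(1) mapE by blast
    define E' where "E' = {y \<in> K. carpet_map n d y \<in> E}"
    have le: "\<delta> / real n ^ Suc k \<le> \<delta>"
      using \<delta> n_pos one_le_power[of "real n" "Suc k"] by (simp add: divide_le_eq del: power_Suc)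
    have E: "E \<subseteq> carpet_map n d ` E'"
    proof
      fix x assume x: "x \<in> E"
      then obtain e y where e: "e \<in> \<Lambda>" "y \<in> K" "x = carpet_map n e y" using Suc.prems(1) mapE by blast
      have "dist x0 x < \<delta>" using Suc.prems(3)[OF x0 x] le by simp
      then have "d = e" using sep d e by blast
      then show "x \<in> carpet_map n d ` E'" using e x unfolding E'_def by blast
    qed
    have "\<exists>w\<in>words k. E' \<subseteq> cyl w"
    proof (rule Suc.IH)
      show "E' \<subseteq> K" unfolding E'_def by blast
      show "E' \<noteq> {}" using E x0 by blast
      fix x y assume "x \<in> E'" "y \<in> E'"
      then have "dist (carpet_map n d x) (carpet_map n d y) < \<delta> / real n ^ Suc k"
        using Suc.prems(3) unfolding E'_def by blast
      then have "dist x y / real n < (\<delta> / real n ^ k) / real n"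
        using dist_word_map[of "[d]" x y] by (simp add: mult.commute)
      then show "dist x y < \<delta> / real n ^ k"
        using n_pos by (simp add: divide_less_cancel del: divide_divide_eq_left)
    qed
    then obtain w where "w \<in> words k" "E' \<subseteq> cyl w" by blast
    then have "d # w \<in> words (Suc k)" "E \<subseteq> cyl (d # w)"
      using d(1) E \<open>w \<in> words k\<close> \<open>E' \<subseteq> cyl w\<close> unfolding cyl_Cons by (simp, blast)
    then show ?case by blast
  qed auto
  with \<delta> show ?thesis by (rule that)
qed

lemma diameter_bound:
  obtains B where "B > 0" "\<And>x y. x \<in> K \<Longrightarrow> y \<in> K \<Longrightarrow> dist x y \<le> B"
proof -
  obtain B where "\<And>x y. x \<in> K \<Longrightarrow> y \<in> K \<Longrightarrow> dist x y \<le> B"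
    using carpet_bounded[OF n_ge_2 digits] by (metis bounded_two_points)
  then show ?thesis by (intro that[of "max 1 B"]) (simp, meson max.coboundedI2)
qed

lemma large_power: "c > 0 \<Longrightarrow> \<exists>k. b < c * real n ^ k"
  using real_arch_pow[of "real n" "b / c"] n_ge_2 by (auto simp: field_simps)

end

section \<open>A cylinder covered by finitely many images of cylinders\<close>

locale carpet_self_embedding = separated_carpet +
  fixes r :: real and f :: "real \<times> real \<Rightarrow> real \<times> real"
  assumes similitude_f: "similitude r f" and into: "f ` K \<subseteq> K"
begin

text \<open>The embedding acts on words once a fixed number \<open>c\<close> of digits is spent: it carries each cylinder
  of depth \<open>k + c\<close> into a cylinder of depth \<open>k\<close>.\<close>
definition refines :: "nat \<Rightarrow> bool" where
  "refines c \<longleftrightarrow> (\<forall>k. \<forall>w\<in>words (k + c). \<exists>u\<in>words k. f ` cyl w \<subseteq> cyl u)"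

definition captured :: "nat \<Rightarrow> (nat \<times> nat) list \<Rightarrow> (nat \<times> nat) list set" where
  "captured c u = {w \<in> words (length u + c). f ` cyl w \<subseteq> cyl u}"

lemma dist_f: "dist (f p) (f q) = r * dist p q" and r_pos: "r > 0"
  using similitude_f unfolding similitude_def by blast+

text \<open>Images of cylinders of depth \<open>k + c\<close> have diameter at most a constant times \<open>n ^ (- k - c)\<close>, so a
  large \<open>c\<close> brings them below the gap at depth \<open>k\<close>.\<close>
lemma refines_exists: "\<exists>c. refines c"
proof -
  obtain \<delta> where \<delta>: "\<delta> > 0" and small: "\<And>k E. E \<subseteq> K \<Longrightarrow> E \<noteq> {} \<Longrightarrow>
      (\<And>x y. x \<in> E \<Longrightarrow> y \<in> E \<Longrightarrow> dist x y < \<delta> / real n ^ k) \<Longrightarrow> \<exists>w\<in>words k. E \<subseteq> cyl w"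
    by (rule small_sets_in_cylinders) blast
  obtain B where B: "B > 0" "\<And>x y. x \<in> K \<Longrightarrow> y \<in> K \<Longrightarrow> dist x y \<le> B" by (rule diameter_bound) blast
  obtain c where c: "r * B < \<delta> * real n ^ c" using large_power[OF \<delta>] by blast
  have "\<exists>u\<in>words k. f ` cyl w \<subseteq> cyl u" if w: "w \<in> words (k + c)" for k w
  proof (rule small)
    show "f ` cyl w \<subseteq> K" using w cyl_subset[of w] into by blast
    show "f ` cyl w \<noteq> {}" using carpet_ne by blast
    fix x y assume "x \<in> f ` cyl w" "y \<in> f ` cyl w"
    then obtain p q where pq: "p \<in> K" "q \<in> K" "x = f (\<phi> w p)" "y = f (\<phi> w q)" by blast
    have "dist x y = r * dist p q / real n ^ (k + c)"
      using w by (simp add: pq dist_f dist_word_map)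
    also have "\<dots> \<le> r * B / real n ^ (k + c)"
      using B(2)[OF pq(1,2)] r_pos n_pos by (intro divide_right_mono mult_left_mono) auto
    also have "\<dots> < \<delta> * real n ^ c / real n ^ (k + c)"
      using c n_pos by (intro divide_strict_right_mono) auto
    also have "\<dots> = \<delta> / real n ^ k" using n_pos by (simp add: power_add)
    finally show "dist x y < \<delta> / real n ^ k" .
  qed
  then show ?thesis unfolding refines_def by blast
qed

text \<open>Cylinders of one depth are disjoint, so a single point decides which cylinder contains the image.\<close>
lemma captured_if_meets:
  assumes "refines c" "u \<in> words k" "w \<in> words (k + c)" "x \<in> cyl w" "f x \<in> cyl u"
  shows "w \<in> captured c u"
proof -
  obtain u' where u': "u' \<in> words k" "f ` cyl w \<subseteq> cyl u'" using assms unfolding refines_def by blast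
  then have "u' = u" using assms by (intro cyl_unique[of u' k u "f x"]) auto
  then show ?thesis using u' assms unfolding captured_def by auto
qed

lemma captured_children:
  assumes "refines c" "u \<in> words k"
  shows "(\<Union>d\<in>\<Lambda>. captured c (u @ [d])) = (\<lambda>(w, d). w @ [d]) ` (captured c u \<times> \<Lambda>)" (is "?L = ?R")
proof
  obtain z where z: "z \<in> K" using carpet_ne by blast
  show "?L \<subseteq> ?R"
  proof
    fix w' assume "w' \<in> ?L"
    then obtain d where d: "d \<in> \<Lambda>" "w' \<in> captured c (u @ [d])" by blast
    then have w': "w' \<in> words (Suc (k + c))" "f ` cyl w' \<subseteq> cyl (u @ [d])"
      using assms(2) unfolding captured_def by auto
    then obtain w e where w: "w' = w @ [e]" "w \<in> words (k + c)" "e \<in> \<Lambda>"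
      by (cases w' rule: rev_cases) auto
    have 1: "\<phi> w' z \<in> cyl w"
      by (rule cyl_appendD[of _ w "[e]"]) (use w z in \<open>auto simp del: foldr_append\<close>)
    have "f (\<phi> w' z) \<in> cyl (u @ [d])" using w'(2) z by blast
    then have 2: "f (\<phi> w' z) \<in> cyl u" by (rule cyl_appendD) (use d in simp)
    have "w \<in> captured c u" by (rule captured_if_meets[OF assms w(2) 1 2])
    then show "w' \<in> ?R" using w by auto
  qed
  show "?R \<subseteq> ?L"
  proof
    fix w' assume "w' \<in> ?R"
    then obtain w e where w: "w' = w @ [e]" "w \<in> captured c u" "e \<in> \<Lambda>" by auto
    then have w': "w' \<in> words (Suc k + c)" using assms(2) unfolding captured_def by auto
    then obtain u' where u': "u' \<in> words (Suc k)" "f ` cyl w' \<subseteq> cyl u'"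
      using assms(1) unfolding refines_def by blast
    then obtain v d where v: "u' = v @ [d]" "v \<in> words k" "d \<in> \<Lambda>"
      by (cases u' rule: rev_cases) auto
    have "f (\<phi> w' z) \<in> cyl (v @ [d])" using u'(2) v(1) z by blast
    then have "f (\<phi> w' z) \<in> cyl v" by (rule cyl_appendD) (use v in simp)
    moreover have "\<phi> w' z \<in> cyl (w @ [e])" using w(1) z by blast
    then have "\<phi> w' z \<in> cyl w" by (rule cyl_appendD) (use w in simp)
    then have "f (\<phi> w' z) \<in> cyl u" using w(2) unfolding captured_def by blast
    ultimately have "v = u" using cyl_unique v assms(2) by blast
    then show "w' \<in> ?L" using v u' w' assms(2) unfolding captured_def by auto
  qed
qed

lemma finite_captured: "finite (captured c u)"
  unfolding captured_def by (rule finite_subset[OF _ finite_words[of "length u + c"]]) auto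

text \<open>A mean value property. Each word captured by \<open>u\<close> has \<open>card \<Lambda>\<close> one-digit extensions, and these are
  distributed among the children of \<open>u\<close>. Hence the number of words captured by \<open>u\<close> is the average of
  the numbers captured by its children.\<close>
lemma sum_card_captured:
  assumes "refines c" "u \<in> words k"
  shows "(\<Sum>d\<in>\<Lambda>. card (captured c (u @ [d]))) = card \<Lambda> * card (captured c u)"
proof -
  obtain z where z: "z \<in> K" using carpet_ne by blast
  have disj: "captured c (u @ [d]) \<inter> captured c (u @ [e]) = {}" if "d \<in> \<Lambda>" "e \<in> \<Lambda>" "d \<noteq> e" for d e
  proof (rule ccontr)
    assume "\<not> ?thesis"
    then obtain w where "f (\<phi> w z) \<in> cyl (u @ [d])" "f (\<phi> w z) \<in> cyl (u @ [e])"
      using z unfolding captured_def by blast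
    then have "u @ [d] = u @ [e]" using that assms(2) by (intro cyl_unique[of _ "Suc k"]) auto
    then show False using that by simp
  qed
  have "(\<Sum>d\<in>\<Lambda>. card (captured c (u @ [d]))) = card (\<Union>d\<in>\<Lambda>. captured c (u @ [d]))"
    by (rule card_UN_disjoint[symmetric]) (use finite_digits finite_captured disj in auto)
  also have "\<dots> = card (captured c u \<times> \<Lambda>)"
    unfolding captured_children[OF assms] by (rule card_image) (auto simp: inj_on_def)
  finally show ?thesis by (simp add: card_cartesian_product mult.commute)
qed

text \<open>The cylinders captured by \<open>u\<close> lie in the preimage of \<open>cyl u\<close>, which again is so small that a
  cylinder about as deep as \<open>u\<close> contains it; that cylinder has boundedly many subcylinders of the
  depth in question.\<close>
lemma card_captured_bounded: "\<exists>M. \<forall>u. set u \<subseteq> \<Lambda> \<longrightarrow> card (captured c u) \<le> M"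
proof -
  obtain \<delta> where \<delta>: "\<delta> > 0" and small: "\<And>k E. E \<subseteq> K \<Longrightarrow> E \<noteq> {} \<Longrightarrow>
      (\<And>x y. x \<in> E \<Longrightarrow> y \<in> E \<Longrightarrow> dist x y < \<delta> / real n ^ k) \<Longrightarrow> \<exists>w\<in>words k. E \<subseteq> cyl w"
    by (rule small_sets_in_cylinders) blast
  obtain B where B: "B > 0" "\<And>x y. x \<in> K \<Longrightarrow> y \<in> K \<Longrightarrow> dist x y \<le> B" by (rule diameter_bound) blast
  obtain b where "B < (r * \<delta>) * real n ^ b" using large_power[of "r * \<delta>" B] \<delta> r_pos by auto
  then have b: "B / r < \<delta> * real n ^ b" using r_pos by (simp add: pos_divide_less_eq mult.commute mult.left_commute)
  have m: "card \<Lambda> \<ge> 1" using finite_digits nonempty by (simp add: Suc_leI card_gt_0_iff)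
  have "card (captured c u) \<le> card \<Lambda> ^ (b + c)" if u: "set u \<subseteq> \<Lambda>" for u
  proof (cases "captured c u = {} \<or> length u < b")
    case True
    then show ?thesis
    proof
      assume "length u < b"
      have "card (captured c u) \<le> card (words (length u + c))"
        by (rule card_mono[OF finite_words]) (auto simp: captured_def)
      also have "\<dots> \<le> card \<Lambda> ^ (b + c)"
        unfolding card_words using \<open>length u < b\<close> m by (intro power_increasing) auto
      finally show ?thesis .
    qed simp
  next
    case False
    (* The preimage of cyl u is small enough for a cylinder b levels above the depth of u. *)
    define k where "k = length u - b"
    have k: "length u = k + b" using False by (simp add: k_def)
    let ?E = "\<Union>w\<in>captured c u. cyl w"
    have "\<exists>v\<in>words k. ?E \<subseteq> cyl v"
    proof (rule small)
      show "?E \<subseteq> K" by (rule UN_least, rule cyl_subset) (simp add: captured_def)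
      show "?E \<noteq> {}" using False carpet_ne by simp
      have fE: "f x \<in> cyl u" if x: "x \<in> ?E" for x
      proof -
        obtain w where "w \<in> captured c u" "x \<in> cyl w" using x by blast
        then show ?thesis unfolding captured_def by blast
      qed
      fix x y assume x: "x \<in> ?E" and y: "y \<in> ?E"
      from fE[OF x] fE[OF y] obtain p q where pq: "p \<in> K" "q \<in> K" "f x = \<phi> u p" "f y = \<phi> u q" by blast
      have "r * dist x y = dist p q / real n ^ (k + b)"
        using dist_word_map[of u p q] dist_f[of x y] k pq by simp
      also have "\<dots> \<le> B / real n ^ (k + b)"
        using B(2)[OF pq(1,2)] n_pos by (intro divide_right_mono) auto
      finally have "dist x y \<le> (B / real n ^ (k + b)) / r"
        using r_pos by (simp only: pos_le_divide_eq mult.commute)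
      also have "\<dots> = (B / r) / real n ^ (k + b)" by simp
      also have "\<dots> < \<delta> * real n ^ b / real n ^ (k + b)"
        using b n_pos by (intro divide_strict_right_mono) auto
      also have "\<dots> = \<delta> / real n ^ k" using n_pos by (simp add: power_add)
      finally show "dist x y < \<delta> / real n ^ k" .
    qed
    then obtain v where v: "v \<in> words k" "?E \<subseteq> cyl v" by blast
    obtain z where z: "z \<in> K" using carpet_ne by blast
    have "captured c u \<subseteq> (\<lambda>t. v @ t) ` words (b + c)"
    proof
      fix w assume w: "w \<in> captured c u"
      then have ww: "w \<in> words (k + (b + c))" using k unfolding captured_def by auto
      obtain w1 w2 where w12: "w = w1 @ w2" "w1 \<in> words k" "w2 \<in> words (b + c)"
        using ww by (rule words_split)
      have "\<phi> w z \<in> cyl (w1 @ w2)" using w12(1) z by blast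
      then have "\<phi> w z \<in> cyl w1" by (rule cyl_appendD) (use w12 in simp)
      moreover have "cyl w \<subseteq> cyl v" using v(2) w by (rule UN_subset_iff[THEN iffD1, rule_format])
      then have "\<phi> w z \<in> cyl v" using z by blast
      ultimately have "w1 = v" using cyl_unique w12(2) v(1) by blast
      then show "w \<in> (\<lambda>t. v @ t) ` words (b + c)" using w12 by blast
    qed
    then have "card (captured c u) \<le> card (words (b + c))"
      by (rule surj_card_le[OF finite_words])
    then show ?thesis by (simp add: card_words)
  qed
  then show ?thesis by blast
qed

text \<open>A bounded function with values in the integers attains its maximum, and by the mean value property
  a maximum at \<open>u\<close> forces the same value at every descendant of \<open>u\<close>. This value is positive
  because the empty word captures all words of length \<open>c\<close>, so the image of the carpet meets every
  cylinder inside \<open>cyl u\<close>.\<close>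
lemma maximal_captured:
  assumes "refines c"
  obtains u where "set u \<subseteq> \<Lambda>" "\<And>v. set v \<subseteq> \<Lambda> \<Longrightarrow> captured c (u @ v) \<noteq> {}"
proof -
  obtain M where M: "\<And>u. set u \<subseteq> \<Lambda> \<Longrightarrow> card (captured c u) \<le> M"
    using card_captured_bounded by blast
  have "\<exists>u. set u \<subseteq> \<Lambda> \<and> (\<forall>v. set v \<subseteq> \<Lambda> \<longrightarrow> card (captured c v) \<le> card (captured c u))"
    by (rule ex_has_greatest_nat[of _ "[]" _ "Suc M"]) (use M in \<open>auto simp: less_Suc_eq_le\<close>)
  then obtain u where u: "set u \<subseteq> \<Lambda>"
    and max: "\<And>v. set v \<subseteq> \<Lambda> \<Longrightarrow> card (captured c v) \<le> card (captured c u)" by blast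
  have const: "card (captured c (u @ v)) = card (captured c u)" if "set v \<subseteq> \<Lambda>" for v
    using that
  proof (induction v rule: rev_induct)
    case (snoc e v)
    then have uv: "u @ v \<in> words (length (u @ v))" "e \<in> \<Lambda>"
      and IH: "card (captured c (u @ v)) = card (captured c u)" using u by auto
    have le: "card (captured c ((u @ v) @ [d])) \<le> card (captured c u)" if "d \<in> \<Lambda>" for d
      using max[of "(u @ v) @ [d]"] uv that by simp
    have "(\<Sum>d\<in>\<Lambda>. card (captured c ((u @ v) @ [d]))) = (\<Sum>d\<in>\<Lambda>. card (captured c u))"
      using sum_card_captured[OF assms uv(1)] IH by simp
    then have "card (captured c ((u @ v) @ [e])) = card (captured c u)"
      using le uv(2) finite_digits by (rule sum_mono_inv)
    then show ?case by simp
  qed simp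
  obtain z w where z: "z \<in> K" "w \<in> words c" "z \<in> cyl w" using carpet_ne cyl_cover by blast
  have "w \<in> captured c []"
    using into z cyl_subset[of w] unfolding captured_def by auto
  then have "card (captured c []) > 0" using finite_captured by (auto simp: card_gt_0_iff)
  then have "card (captured c u) > 0" using max[of "[]"] by simp
  then have "captured c (u @ v) \<noteq> {}" if "set v \<subseteq> \<Lambda>" for v using const[OF that] by auto
  then show ?thesis using that u by blast
qed

text \<open>The image meets every cylinder inside \<open>cyl u\<close>, so it is dense there, and being closed it fills
  \<open>cyl u\<close>. In particular the image has interior relative to the carpet; the form with finitely many
  cylinders of equal depth is the one needed for comparing extreme points.\<close>
lemma cyl_covered_by_image:
  obtains c u where "set u \<subseteq> \<Lambda>" "captured c u \<noteq> {}" "cyl u = (\<Union>w\<in>captured c u. f ` cyl w)"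
proof -
  obtain c where c: "refines c" using refines_exists by blast
  obtain u where u: "set u \<subseteq> \<Lambda>" "\<And>v. set v \<subseteq> \<Lambda> \<Longrightarrow> captured c (u @ v) \<noteq> {}"
    using maximal_captured[OF c] by blast
  obtain B where B: "B > 0" "\<And>x y. x \<in> K \<Longrightarrow> y \<in> K \<Longrightarrow> dist x y \<le> B" by (rule diameter_bound) blast
  let ?U = "\<Union>w\<in>captured c u. f ` cyl w"
  have contf: "continuous_on A f" for A
    using r_pos by (intro lipschitz_on_continuous_on[of r]) (auto simp: lipschitz_on_def dist_f)
  have contw: "continuous_on A (\<phi> w)" for A w
    using n_pos by (intro lipschitz_on_continuous_on[of "1 / real n ^ length w"])
      (auto simp: lipschitz_on_def dist_word_map)
  have closed: "closed ?U"
    by (intro compact_imp_closed compact_UN finite_captured compact_continuous_image contf contw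
        carpet_compact[OF n_ge_2 digits])
  have "cyl u \<subseteq> ?U"
  proof
    fix x assume x: "x \<in> cyl u"
    show "x \<in> ?U"
    proof (rule ccontr)
      assume "x \<notin> ?U"
      then obtain \<epsilon> where \<epsilon>: "\<epsilon> > 0" "\<And>y. y \<in> ?U \<Longrightarrow> \<epsilon> \<le> dist x y"
        using separate_point_closed[OF closed] by metis
      obtain k where k: "B < \<epsilon> * real n ^ k" using large_power[OF \<epsilon>(1)] by blast
      obtain p where p: "p \<in> K" "x = \<phi> u p" using x by blast
      then obtain v where v: "v \<in> words k" "p \<in> cyl v" using cyl_cover by blast
      then obtain w where w: "w \<in> captured c (u @ v)" using u(2)[of v] by blast
      then have ww: "w \<in> words ((length u + c) + k)" "f ` cyl w \<subseteq> cyl (u @ v)"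
        using v unfolding captured_def by auto
      obtain w1 w2 where w12: "w = w1 @ w2" "w1 \<in> words (length u + c)" "w2 \<in> words k"
        using ww(1) by (rule words_split)
      obtain z where z: "z \<in> K" using carpet_ne by blast
      have "\<phi> w z \<in> cyl (w1 @ w2)" using w12(1) z by blast
      then have zw: "\<phi> w z \<in> cyl w1" by (rule cyl_appendD) (use w12 in simp)
      have fz: "f (\<phi> w z) \<in> cyl (u @ v)" using ww(2) z by blast
      then have "f (\<phi> w z) \<in> cyl u" by (rule cyl_appendD) (use v in simp)
      then have "w1 \<in> captured c u" using captured_if_meets[OF c _ w12(2) zw] u(1) by blast
      then have "\<epsilon> \<le> dist x (f (\<phi> w z))" using \<epsilon>(2) zw by blast
      moreover have "dist x (f (\<phi> w z)) \<le> B / real n ^ k"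
      proof -
        obtain y where y: "y \<in> K" "f (\<phi> w z) = \<phi> (u @ v) y" using fz by blast
        obtain q where q: "q \<in> K" "p = \<phi> v q" using v(2) by blast
        have "dist x (f (\<phi> w z)) = dist q y / real n ^ (length u + k)"
          using dist_word_map[of "u @ v" q y] y p q v by simp
        also have "\<dots> \<le> B / real n ^ (length u + k)"
          using B(2)[OF q(1) y(1)] n_pos by (intro divide_right_mono) auto
        also have "\<dots> \<le> B / real n ^ k"
          using B n_pos by (intro divide_left_mono power_increasing) auto
        finally show ?thesis .
      qed
      ultimately have "\<epsilon> \<le> B / real n ^ k" by simp
      then show False using k n_pos by (simp add: field_simps)
    qed
  qed
  moreover have "?U \<subseteq> cyl u" unfolding captured_def by blast
  ultimately show ?thesis using that[of u c] u(1) u(2)[of "[]"] by simp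
qed

end

section \<open>Normals of the edges of the convex hull\<close>

definition maximizes :: "'a::real_inner \<Rightarrow> 'a set \<Rightarrow> 'a \<Rightarrow> bool" where
  "maximizes v S x \<longleftrightarrow> x \<in> S \<and> (\<forall>y\<in>S. y \<bullet> v \<le> x \<bullet> v)"

text \<open>For a compact planar set with at least two points these are \<open>0\<close> and the outer normals of the edges
  of the convex hull, a segment having two opposite normals. The description by maximal points makes
  them easy to compare under similitudes.\<close>
definition edge_normals :: "'a::real_inner set \<Rightarrow> 'a set" where
  "edge_normals S = {v. \<exists>x y. x \<noteq> y \<and> maximizes v S x \<and> maximizes v S y}"

lemma finite_maximizer:
  fixes g :: "'a \<Rightarrow> real"
  assumes "finite S" "S \<noteq> {}" obtains x where "x \<in> S" "\<And>y. y \<in> S \<Longrightarrow> g y \<le> g x"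
proof -
  have "Max (g ` S) \<in> g ` S" using assms by simp
  then obtain x where "x \<in> S" "g x = Max (g ` S)" by auto
  then show ?thesis using that assms by (metis Max_ge finite_imageI imageI)
qed

text \<open>Start from a point \<open>d\<close> that is furthest to the right. If there are several such points, the right
  side of the hull is a vertical edge. Otherwise the upper edge at \<open>d\<close> leads to a point with the
  greatest rise \<open>t e\<close> per unit step to the left.\<close>
lemma edge_normal_exists:
  fixes S :: "(real \<times> real) set"
  assumes "finite S" "x0 \<in> S" "y0 \<in> S" "x0 \<noteq> y0"
  obtains v where "v \<noteq> 0" "v \<in> edge_normals S"
proof -
  obtain d where d: "d \<in> S" "\<And>e. e \<in> S \<Longrightarrow> fst e \<le> fst d"
    using finite_maximizer[OF assms(1)] assms(2) by blast
  show ?thesis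
  proof (cases "\<exists>e\<in>S. e \<noteq> d \<and> fst e = fst d")
    case True
    then obtain e where "e \<in> S" "e \<noteq> d" "fst e = fst d" by blast
    then have "(1, 0) \<in> edge_normals S"
      using d unfolding edge_normals_def maximizes_def
      by (intro CollectI exI[of _ d] exI[of _ e]) (auto simp: inner_prod_def)
    then show ?thesis using that[of "(1, 0)"] by (simp add: zero_prod_def)
  next
    case False
    then have less: "fst e < fst d" if "e \<in> S" "e \<noteq> d" for e using d(2)[OF that(1)] that by fastforce
    define t where "t e = (snd e - snd d) / (fst d - fst e)" for e
    have "S - {d} \<noteq> {}" using assms by blast
    then obtain e where e: "e \<in> S" "e \<noteq> d" "\<And>e'. e' \<in> S \<Longrightarrow> e' \<noteq> d \<Longrightarrow> t e' \<le> t e"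
      using finite_maximizer[of "S - {d}" t] assms(1) by (metis finite_Diff DiffD1 DiffD2 DiffI singletonD singletonI)
    have te: "snd e' - snd d = t e' * (fst d - fst e')" if "e' \<in> S" "e' \<noteq> d" for e'
      using less[OF that] by (simp add: t_def)
    have le: "e' \<bullet> (t e, 1) \<le> d \<bullet> (t e, 1)" if "e' \<in> S" for e'
    proof (cases "e' = d")
      case False
      have "t e' * (fst d - fst e') \<le> t e * (fst d - fst e')"
        using less[OF that False] e(3)[OF that False] by (intro mult_right_mono) auto
      then show ?thesis using te[OF that False] by (simp add: inner_prod_def algebra_simps)
    qed simp
    have eq: "e \<bullet> (t e, 1) = d \<bullet> (t e, 1)"
      using te[OF e(1,2)] by (simp add: inner_prod_def algebra_simps)
    have "(t e, 1) \<in> edge_normals S"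
      unfolding edge_normals_def maximizes_def
    proof (intro CollectI exI conjI ballI)
      show "e \<noteq> d" "e \<in> S" "d \<in> S" using e d by auto
    qed (use le eq in \<open>simp_all\<close>)
    then show ?thesis using that[of "(t e, 1)"] by (simp add: zero_prod_def)
  qed
qed

lemma inner_rotation: "rotation \<theta> p \<bullet> rotation \<theta> q = p \<bullet> q"
proof -
  obtain x y u v where [simp]: "p = (x, y)" "q = (u, v)" by (cases p, cases q)
  have "rotation \<theta> p \<bullet> rotation \<theta> q = ((cos \<theta>)\<^sup>2 + (sin \<theta>)\<^sup>2) * (x * u + y * v)"
    by (simp add: inner_prod_def algebra_simps power2_eq_square del: sin_cos_squared_add sin_cos_squared_add2 sin_cos_squared_add3)
  then show ?thesis by (simp add: inner_prod_def)
qed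

lemma linear_rotation: "linear (rotation \<theta>)"
  by (rule linearI) (auto simp: algebra_simps)

lemma rotation_rotation: "rotation \<alpha> (rotation \<beta> p) = rotation (\<alpha> + \<beta>) p"
  by (cases p) (simp add: cos_add sin_add algebra_simps)

abbreviation digit :: "nat \<times> nat \<Rightarrow> real \<times> real" where
  "digit d \<equiv> (real (fst d), real (snd d))"

lemma digit_inject: "digit d = digit e \<longleftrightarrow> d = e"
  by (simp add: prod_eq_iff)

context separated_carpet
begin

lemma inner_carpet_map: "carpet_map n d x \<bullet> v = (x \<bullet> v + digit d \<bullet> v) / real n"
  by (simp add: carpet_map_eq inner_add_left del: scaleR_Pair inner_Pair)

text \<open>A linear functional is maximal on the carpet exactly at the points all of whose digits maximize it
  on the digit set; this is the step for the leading digit.\<close>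
lemma maximizes_carpet_map:
  assumes "d \<in> \<Lambda>" "x \<in> K"
  shows "maximizes v K (carpet_map n d x) \<longleftrightarrow> maximizes v K x \<and> maximizes v (digit ` \<Lambda>) (digit d)"
proof
  assume max: "maximizes v K (carpet_map n d x)"
  have K: "carpet_map n e y \<bullet> v \<le> carpet_map n d x \<bullet> v" if "e \<in> \<Lambda>" "y \<in> K" for e y
    using max map_in[OF that] unfolding maximizes_def by blast
  have le: "y \<bullet> v + digit e \<bullet> v \<le> x \<bullet> v + digit d \<bullet> v" if "e \<in> \<Lambda>" "y \<in> K" for e y
    using K[OF that] n_pos by (simp add: inner_carpet_map divide_le_cancel del: inner_Pair)
  show "maximizes v K x \<and> maximizes v (digit ` \<Lambda>) (digit d)"
    unfolding maximizes_def using le[OF assms(1)] le[OF _ assms(2)] assms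
    by (simp del: inner_Pair split_paired_All)
next
  assume max: "maximizes v K x \<and> maximizes v (digit ` \<Lambda>) (digit d)"
  have "z \<bullet> v \<le> carpet_map n d x \<bullet> v" if "z \<in> K" for z
  proof -
    obtain e y where e: "e \<in> \<Lambda>" "y \<in> K" "z = carpet_map n e y" using \<open>z \<in> K\<close> by (rule mapE)
    have "y \<bullet> v \<le> x \<bullet> v" "digit e \<bullet> v \<le> digit d \<bullet> v" using e max unfolding maximizes_def by blast+
    then show ?thesis
      unfolding e(3) inner_carpet_map by (intro divide_right_mono add_mono) auto
  qed
  then show "maximizes v K (carpet_map n d x)"
    using map_in[OF assms] unfolding maximizes_def by blast
qed

text \<open>Two maximal points with the same leading digit stay maximal after this digit is removed, while
  their distance grows by the factor \<open>n\<close>. As the carpet is bounded, two different maximizing digits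
  must turn up.\<close>
lemma edge_normals_carpet: "edge_normals K = edge_normals (digit ` \<Lambda>)"
proof
  show "edge_normals (digit ` \<Lambda>) \<subseteq> edge_normals K"
  proof
    fix v assume "v \<in> edge_normals (digit ` \<Lambda>)"
    then obtain d e where de: "d \<in> \<Lambda>" "e \<in> \<Lambda>" "d \<noteq> e"
        "maximizes v (digit ` \<Lambda>) (digit d)" "maximizes v (digit ` \<Lambda>) (digit e)"
      unfolding edge_normals_def maximizes_def by blast
    have "\<exists>x\<in>K. \<forall>y\<in>K. y \<bullet> v \<le> x \<bullet> v"
      by (intro continuous_attains_sup carpet_compact[OF n_ge_2 digits] carpet_ne continuous_intros)
    then obtain x where x: "maximizes v K x" "x \<in> K" unfolding maximizes_def by blast
    have "maximizes v K (carpet_map n d x)" "maximizes v K (carpet_map n e x)"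
      using maximizes_carpet_map[OF de(1) x(2)] maximizes_carpet_map[OF de(2) x(2)] de x by auto
    moreover have "carpet_map n d x \<noteq> carpet_map n e x"
      using digit_unique[OF de(1,2) x(2) x(2)] de(3) by blast
    ultimately show "v \<in> edge_normals K" unfolding edge_normals_def by blast
  qed
  show "edge_normals K \<subseteq> edge_normals (digit ` \<Lambda>)"
  proof (rule subsetI, rule ccontr)
    fix v assume v: "v \<in> edge_normals K" "v \<notin> edge_normals (digit ` \<Lambda>)"
    obtain x0 y0 where xy0: "x0 \<noteq> y0" "maximizes v K x0" "maximizes v K y0"
      using v(1) unfolding edge_normals_def by blast
    have "\<exists>x y. maximizes v K x \<and> maximizes v K y \<and> dist x y = real n ^ k * dist x0 y0" for k
    proof (induction k)
      case 0
      show ?case using xy0 by (intro exI[of _ x0] exI[of _ y0]) simp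
    next
      case (Suc k)
      then obtain x y where xy: "maximizes v K x" "maximizes v K y" "dist x y = real n ^ k * dist x0 y0"
        by blast
      have "x \<in> K" "y \<in> K" using xy unfolding maximizes_def by blast+
      then obtain d e x' y' where d: "d \<in> \<Lambda>" "x' \<in> K" "x = carpet_map n d x'"
        and e: "e \<in> \<Lambda>" "y' \<in> K" "y = carpet_map n e y'" by (metis mapE)
      have max: "maximizes v K x'" "maximizes v K y'"
          "maximizes v (digit ` \<Lambda>) (digit d)" "maximizes v (digit ` \<Lambda>) (digit e)"
        using maximizes_carpet_map[OF d(1,2)] maximizes_carpet_map[OF e(1,2)] xy d e by auto
      then have "digit d = digit e" using v(2) unfolding edge_normals_def by blast
      then have "d = e" by (simp only: digit_inject)
      then have "dist x y = dist x' y' / real n" using d e dist_word_map[of "[d]" x' y'] by simp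
      then have "dist x' y' = real n ^ Suc k * dist x0 y0" using xy(3) n_pos by (simp add: field_simps)
      then show ?case using max by blast
    qed
    moreover obtain B where B: "\<And>x y. x \<in> K \<Longrightarrow> y \<in> K \<Longrightarrow> dist x y \<le> B" by (rule diameter_bound) blast
    ultimately have "real n ^ k * dist x0 y0 \<le> B" for k unfolding maximizes_def by metis
    moreover have "\<exists>k. B < dist x0 y0 * real n ^ k" using large_power xy0 by simp
    ultimately show False by (metis mult.commute not_le)
  qed
qed

text \<open>Two different maximizing digits have a difference perpendicular to \<open>v\<close>, and this difference is an
  integer vector of bounded length.\<close>
lemma edge_normal_rational:
  assumes "v \<in> edge_normals K"
  obtains p q :: int where "0 < p\<^sup>2 + q\<^sup>2" "p\<^sup>2 + q\<^sup>2 \<le> 2 * (int n)\<^sup>2" "v \<bullet> (of_int p, of_int q) = 0"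
proof -
  obtain d e where de: "d \<in> \<Lambda>" "e \<in> \<Lambda>" "d \<noteq> e" "digit d \<bullet> v \<le> digit e \<bullet> v" "digit e \<bullet> v \<le> digit d \<bullet> v"
    using assms[unfolded edge_normals_carpet] unfolding edge_normals_def maximizes_def by blast
  define p q where "p = int (fst d) - int (fst e)" and "q = int (snd d) - int (snd e)"
  have "d \<in> {0..<n} \<times> {0..<n}" "e \<in> {0..<n} \<times> {0..<n}" using de digits by blast+
  then have "\<bar>p\<bar> \<le> int n" "\<bar>q\<bar> \<le> int n" unfolding p_def q_def by auto
  then have "p\<^sup>2 \<le> (int n)\<^sup>2" "q\<^sup>2 \<le> (int n)\<^sup>2" by (simp_all add: abs_le_square_iff[symmetric])
  then have 1: "p\<^sup>2 + q\<^sup>2 \<le> 2 * (int n)\<^sup>2" by simp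
  have "p \<noteq> 0 \<or> q \<noteq> 0" using de(3) unfolding p_def q_def by (auto simp: prod_eq_iff)
  then have 2: "0 < p\<^sup>2 + q\<^sup>2" by (simp add: sum_power2_gt_zero_iff)
  have "v \<bullet> (of_int p, of_int q) = v \<bullet> (digit d - digit e)" by (simp add: p_def q_def)
  also have "\<dots> = 0" using de(4,5) by (simp add: inner_diff_right inner_commute del: inner_Pair diff_Pair)
  finally show ?thesis using that 1 2 by blast
qed

end

context carpet_self_embedding
begin

text \<open>Up to scaling and translation, \<open>cyl u\<close> is the carpet itself, and it is a finite union of
  homothetic copies of the rotated carpet that differ by translations only. The copy that is translated
  furthest in the direction \<open>rotation \<theta> v\<close> carries both points that maximize \<open>v\<close> to points that
  maximize \<open>rotation \<theta> v\<close> on the whole union.\<close>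
lemma rotation_edge_normals:
  assumes f: "f = (\<lambda>p. r *\<^sub>R rotation \<theta> p + a)" and v: "v \<in> edge_normals K"
  shows "rotation \<theta> v \<in> edge_normals K"
proof -
  obtain x y where xy: "x \<noteq> y" "maximizes v K x" "maximizes v K y"
    using v unfolding edge_normals_def by blast
  then have K: "x \<in> K" "y \<in> K" unfolding maximizes_def by blast+
  obtain c u where u: "set u \<subseteq> \<Lambda>" "captured c u \<noteq> {}" "cyl u = (\<Union>w\<in>captured c u. f ` cyl w)"
    by (rule cyl_covered_by_image)
  define \<kappa> where "\<kappa> = r / real n ^ (length u + c)"
  let ?v = "rotation \<theta> v" and ?b = "\<lambda>w. f (\<phi> w 0)"
  have inner: "f (\<phi> w z) \<bullet> ?v = \<kappa> * (z \<bullet> v) + ?b w \<bullet> ?v" if "w \<in> captured c u" for w z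
  proof -
    have "length w = length u + c" using that unfolding captured_def by simp
    then have "f (\<phi> w z) = \<kappa> *\<^sub>R rotation \<theta> z + ?b w"
      unfolding f \<kappa>_def
      by (subst word_map_affine) (simp add: linear_add[OF linear_rotation] linear_scale[OF linear_rotation]
          scaleR_add_right)
    then show ?thesis by (simp add: inner_add_left inner_rotation)
  qed
  (* the copy translated furthest in the rotated direction *)
  obtain w0 where w0: "w0 \<in> captured c u" "\<And>w. w \<in> captured c u \<Longrightarrow> ?b w \<bullet> ?v \<le> ?b w0 \<bullet> ?v"
    using finite_maximizer[OF finite_captured u(2), of "\<lambda>w. ?b w \<bullet> ?v"] by blast
  have top: "\<exists>x'\<in>K. \<phi> u x' = f (\<phi> w0 x) \<and> maximizes ?v K x'" if "maximizes v K x" for x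
  proof -
    have xK: "x \<in> K" using that unfolding maximizes_def by blast
    then have "f (\<phi> w0 x) \<in> cyl u" using u(3) w0(1) by blast
    then obtain x' where x': "x' \<in> K" "\<phi> u x' = f (\<phi> w0 x)" by force
    have "z \<bullet> ?v \<le> x' \<bullet> ?v" if "z \<in> K" for z
    proof -
      have "\<phi> u z \<in> (\<Union>w\<in>captured c u. f ` cyl w)" using u(3) that by blast
      then obtain w z' where w: "w \<in> captured c u" "z' \<in> K" "\<phi> u z = f (\<phi> w z')" by blast
      have "z' \<bullet> v \<le> x \<bullet> v" using \<open>maximizes v K x\<close> w(2) unfolding maximizes_def by blast
      then have "\<kappa> * (z' \<bullet> v) \<le> \<kappa> * (x \<bullet> v)"
        using r_pos n_pos unfolding \<kappa>_def by (intro mult_left_mono) auto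
      then have "\<phi> u z \<bullet> ?v \<le> \<phi> u x' \<bullet> ?v"
        using w0(2)[OF w(1)] unfolding w(3) x'(2)
        using inner[OF w(1), of z'] inner[OF w0(1), of x] by linarith
      then show ?thesis
        using n_pos by (simp add: word_map_affine[of u z] word_map_affine[of u x'] inner_add_left
            divide_le_cancel)
    qed
    then show ?thesis using x' unfolding maximizes_def by blast
  qed
  obtain x' where x': "\<phi> u x' = f (\<phi> w0 x)" "maximizes ?v K x'" using top[OF xy(2)] by blast
  obtain y' where y': "\<phi> u y' = f (\<phi> w0 y)" "maximizes ?v K y'" using top[OF xy(3)] by blast
  have "f (\<phi> w0 x) \<noteq> f (\<phi> w0 y)"
    using dist_f[of "\<phi> w0 x" "\<phi> w0 y"] r_pos inj_word_map[of w0 x y] xy(1) by auto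
  then have "x' \<noteq> y'" using x'(1) y'(1) by auto
  then show ?thesis using x'(2) y'(2) unfolding edge_normals_def by blast
qed

end

section \<open>Rotations with rational multiples\<close>

text \<open>If \<open>x = p / q\<close> in lowest terms, then \<open>x\<^sup>2 - 2\<close> has denominator \<open>q\<^sup>2\<close> in lowest terms. The
  denominators along the orbit therefore grow without bound unless \<open>q = 1\<close>. The map is the doubling
  of the angle in terms of twice the cosine.\<close>
lemma iterate_common_denominator_imp_Ints:
  fixes x :: real
  assumes D: "D \<noteq> 0" and orbit: "\<And>j. of_int D * ((\<lambda>x. x\<^sup>2 - 2) ^^ j) x \<in> \<int>"
  shows "x \<in> \<int>"
proof -
  obtain m where m: "of_int D * x = of_int m" using orbit[of 0] by (auto elim: Ints_cases)
  have "x = of_int m / of_int D" using m D by (simp add: field_simps)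
  then have "x \<in> \<rat>" by simp
  then obtain p q where q: "q > 0" "coprime p q" "x = of_int p / of_int q" by (rule Rats_cases')
  have iter: "\<exists>P. coprime P q \<and> ((\<lambda>x. x\<^sup>2 - 2) ^^ j) x = of_int P / of_int (q ^ (2 ^ j))" for j
  proof (induction j)
    case 0
    then show ?case using q by auto
  next
    case (Suc j)
    then obtain P where P: "coprime P q" "((\<lambda>x. x\<^sup>2 - 2) ^^ j) x = of_int P / of_int (q ^ (2 ^ j))"
      by blast
    let ?Q = "q ^ (2 ^ j)"
    have "((\<lambda>x. x\<^sup>2 - 2) ^^ Suc j) x = (of_int P / of_int ?Q)\<^sup>2 - 2" by (simp add: P(2))
    also have "\<dots> = of_int (P\<^sup>2 - 2 * ?Q\<^sup>2) / of_int (?Q\<^sup>2)"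
      using q(1) by (simp add: power_divide diff_divide_distrib)
    also have "?Q\<^sup>2 = q ^ (2 ^ Suc j)" by (simp add: power_mult mult.commute flip: power_mult)
    finally have eq: "((\<lambda>x. x\<^sup>2 - 2) ^^ Suc j) x = of_int (P\<^sup>2 - 2 * q ^ (2 ^ Suc j)) / of_int (q ^ (2 ^ Suc j))" .
    have "q dvd 2 * q ^ (2 ^ Suc j)" by simp
    then obtain m where m: "2 * q ^ (2 ^ Suc j) = q * m" by (rule dvdE)
    have P2: "coprime (P\<^sup>2) q" using P(1) by simp
    have "coprime (P\<^sup>2 - 2 * q ^ (2 ^ Suc j)) q"
      unfolding m
    proof (intro coprimeI)
      fix c assume c: "c dvd P\<^sup>2 - q * m" "c dvd q"
      then have "c dvd (P\<^sup>2 - q * m) + q * m" by (intro dvd_add dvd_mult2)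
      then have "c dvd P\<^sup>2" by simp
      then show "is_unit c" using coprime_common_divisor[OF P2] c(2) by blast
    qed
    then show ?case using eq by blast
  qed
  have "q = 1"
  proof (rule ccontr)
    assume "q \<noteq> 1"
    with q(1) have q2: "q \<ge> 2" by simp
    (* so late in the orbit that the denominator exceeds D *)
    define j where "j = nat \<bar>D\<bar>"
    obtain P where P: "coprime P q" "((\<lambda>x. x\<^sup>2 - 2) ^^ j) x = of_int P / of_int (q ^ (2 ^ j))"
      using iter by blast
    obtain m where "of_int D * (of_int P / of_int (q ^ (2 ^ j))) = (of_int m :: real)"
      using orbit[of j] unfolding P(2) by (auto elim: Ints_cases)
    then have "of_int (D * P) = (of_int (m * q ^ (2 ^ j)) :: real)"
      using q(1) by (simp add: field_simps)
    then have "D * P = m * q ^ (2 ^ j)" by (simp only: of_int_eq_iff)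
    then have "q ^ (2 ^ j) dvd P * D" by (metis dvd_triv_right mult.commute)
    moreover have "coprime (q ^ (2 ^ j)) P" using P(1) by (simp add: coprime_commute)
    ultimately have "q ^ (2 ^ j) dvd D" by (simp add: coprime_dvd_mult_right_iff)
    then have "q ^ (2 ^ j) \<le> \<bar>D\<bar>" using dvd_imp_le_int[OF D, of "q ^ (2 ^ j)"] q(1) by simp
    moreover have "(2::int) ^ (2 ^ j) \<le> q ^ (2 ^ j)" using q2 by (intro power_mono) auto
    moreover have "int (2 ^ j) < 2 ^ (2 ^ j)" by (metis of_nat_less_iff less_exp of_nat_numeral of_nat_power)
    moreover have "\<bar>D\<bar> < int (2 ^ j)" by (metis j_def less_exp of_nat_less_iff abs_ge_zero int_nat_eq)
    ultimately show False by linarith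
  qed
  then show ?thesis using q(3) by simp
qed

lemma no_int_square_triple:
  fixes a b :: int
  assumes "a\<^sup>2 = 3 * b\<^sup>2" shows "b = 0"
proof (rule ccontr)
  assume b: "b \<noteq> 0"
  let ?x = "of_int a / of_int b :: real"
  have sq: "?x\<^sup>2 = 3"
    using arg_cong[OF assms, of "of_int :: int \<Rightarrow> real"] b by (simp add: power_divide)
  have "algebraic_int ?x"
    by (rule algebraic_int_root[of 3 "monom 1 2"]) (auto simp: poly_monom degree_monom_eq sq)
  then have "?x \<in> \<int>" by (rule rational_algebraic_int_is_int) auto
  then obtain m where "?x = of_int m" by (auto elim: Ints_cases)
  then have m: "m\<^sup>2 = 3" using sq by (metis of_int_eq_iff of_int_numeral of_int_power)
  then have "\<bar>m\<bar> < 2" using power2_less_imp_less[of "\<bar>m\<bar>" 2] by simp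
  then have "m \<in> {-1, 0, 1}" by auto
  then show False using m by auto
qed

text \<open>Both \<open>v\<close> and its image are known up to a scalar from the vectors perpendicular to them, so the
  rotation angle is the angle between \<open>p\<close> and \<open>q\<close> up to a multiple of \<open>\<pi>\<close>. The identity expresses its
  cotangent through the inner and the cross product of \<open>p\<close> and \<open>q\<close>, avoiding division by zero.\<close>
lemma perpendicular_rotation:
  assumes "v \<noteq> 0" "v \<bullet> (p1, p2) = 0" "rotation \<alpha> v \<bullet> (q1, q2) = 0"
  shows "cos \<alpha> * (p1 * q2 - p2 * q1) = sin \<alpha> * (p1 * q1 + p2 * q2)"
proof -
  obtain x y where v: "v = (x, y)" by (cases v)
  define c s where "c = cos \<alpha>" and "s = sin \<alpha>"
  have 1: "x * p1 + y * p2 = 0" and 2: "(c * x - s * y) * q1 + (s * x + c * y) * q2 = 0"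
    using assms(2,3) by (simp_all add: v c_def s_def inner_prod_def)
  let ?E = "c * (p1 * q2 - p2 * q1) - s * (p1 * q1 + p2 * q2)"
  have "x * ?E = 0" using 1 2 by algebra
  moreover have "y * ?E = 0" using 1 2 by algebra
  moreover have "x \<noteq> 0 \<or> y \<noteq> 0" using assms(1) by (auto simp: v zero_prod_def)
  ultimately have "?E = 0" by auto
  then show ?thesis by (simp add: c_def s_def)
qed

lemma iterate_double_cos:
  fixes \<theta> :: real
  shows "((\<lambda>x. x\<^sup>2 - 2) ^^ j) (2 * cos (2 * \<theta>)) = 2 * cos (2 * (2 ^ j * \<theta>))"
proof (induction j)
  case (Suc j)
  have "2 * cos (2 * (2 ^ Suc j * \<theta>)) = (2 * cos (2 * (2 ^ j * \<theta>)))\<^sup>2 - 2"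
    using cos_double_cos[of "2 * (2 ^ j * \<theta>)"] by (simp add: power_mult_distrib mult_ac)
  then show ?case using Suc by simp
qed simp

text \<open>A variant of Niven's theorem. The squared cosines of all multiples of \<open>\<theta>\<close> are rational with bounded
  denominators, so \<open>2 * cos (2 * \<theta>)\<close> is an integer between \<open>-2\<close> and \<open>2\<close>. The values \<open>2\<close> and \<open>-2\<close>
  belong to multiples of a right angle, and \<open>1\<close> and \<open>-1\<close> would make \<open>\<surd>3\<close> rational.\<close>
lemma tan_one_if_rational_multiples:
  assumes rat: "\<And>k. \<exists>A B N. int N = A\<^sup>2 + B\<^sup>2 \<and> N \<in> {1..M} \<and>
      cos (real k * \<theta>) * of_int B = sin (real k * \<theta>) * of_int A"
    and "cos \<theta> \<noteq> 0" "sin \<theta> \<noteq> 0"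
  shows "\<bar>tan \<theta>\<bar> = 1"
proof -
  have squares: "(cos t)\<^sup>2 * of_int (A\<^sup>2 + B\<^sup>2) = (of_int A)\<^sup>2 \<and> (sin t)\<^sup>2 * of_int (A\<^sup>2 + B\<^sup>2) = (of_int B)\<^sup>2"
    if "cos t * of_int B = sin t * of_int A" for t :: real and A B :: int
  proof -
    have "(cos t)\<^sup>2 + (sin t)\<^sup>2 = 1" by simp
    with that show ?thesis
      unfolding of_int_add of_int_power by (intro conjI; algebra)
  qed
  have "2 * cos (2 * \<theta>) \<in> \<int>"
  proof (rule iterate_common_denominator_imp_Ints[of "fact M"])
    fix j
    let ?t = "real (2 ^ j) * \<theta>"
    obtain A B N where N: "int N = A\<^sup>2 + B\<^sup>2" "N \<in> {1..M}" "cos ?t * of_int B = sin ?t * of_int A"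
      using rat[of "2 ^ j"] by blast
    have "N dvd fact M" using N(2) by (intro dvd_fact) auto
    then obtain m where "(fact M :: nat) = N * m" by (rule dvdE)
    then have m: "(fact M :: int) = int N * int m" by (metis of_nat_fact of_nat_mult)
    have "of_int (fact M) * (2 * cos (2 * ?t)) = of_int m * (4 * ((cos ?t)\<^sup>2 * of_int (int N))) - 2 * of_int (fact M)"
      unfolding cos_double_cos m by (simp add: algebra_simps)
    also have "(cos ?t)\<^sup>2 * of_int (int N) = (of_int A)\<^sup>2" using squares[OF N(3)] N(1) by simp
    also have "of_int m * (4 * (of_int A)\<^sup>2) - 2 * of_int (fact M) = (of_int (m * (4 * A\<^sup>2) - 2 * fact M) :: real)"
      by simp
    finally show "of_int (fact M) * ((\<lambda>x. x\<^sup>2 - 2) ^^ j) (2 * cos (2 * \<theta>)) \<in> \<int>"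
      unfolding iterate_double_cos by (simp only: of_nat_power of_nat_numeral Ints_of_int)
  qed simp
  then obtain z where z: "2 * cos (2 * \<theta>) = of_int z" by (auto elim: Ints_cases)
  have c: "4 * (cos \<theta>)\<^sup>2 = of_int (z + 2)"
    using z unfolding cos_double_cos by simp
  have "4 * (sin \<theta>)\<^sup>2 = 4 - 4 * (cos \<theta>)\<^sup>2" by (simp add: sin_squared_eq)
  then have s: "4 * (sin \<theta>)\<^sup>2 = of_int (2 - z)" unfolding c by simp
  have "0 < (cos \<theta>)\<^sup>2" "0 < (sin \<theta>)\<^sup>2" using assms by simp_all
  then have "(0::real) < of_int (z + 2)" "(0::real) < of_int (2 - z)" using c s by linarith+
  then have "0 < z + 2" "0 < 2 - z" by (simp_all only: of_int_0_less_iff)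
  then have "z = 0 \<or> z = 1 \<or> z = -1" by linarith
  moreover obtain A B N where N: "int N = A\<^sup>2 + B\<^sup>2" "N \<in> {1..M}" "cos \<theta> * of_int B = sin \<theta> * of_int A"
    using rat[of 1] by auto
  have AB: "(z + 2) * (A\<^sup>2 + B\<^sup>2) = 4 * A\<^sup>2" "(2 - z) * (A\<^sup>2 + B\<^sup>2) = 4 * B\<^sup>2"
  proof -
    have "(of_int ((z + 2) * (A\<^sup>2 + B\<^sup>2)) :: real) = of_int (4 * A\<^sup>2)"
      using squares[OF N(3)] unfolding of_int_mult c[symmetric] by simp
    then show "(z + 2) * (A\<^sup>2 + B\<^sup>2) = 4 * A\<^sup>2" by (simp only: of_int_eq_iff)
    have "(of_int ((2 - z) * (A\<^sup>2 + B\<^sup>2)) :: real) = of_int (4 * B\<^sup>2)"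
      using squares[OF N(3)] unfolding of_int_mult s[symmetric] by simp
    then show "(2 - z) * (A\<^sup>2 + B\<^sup>2) = 4 * B\<^sup>2" by (simp only: of_int_eq_iff)
  qed
  have "A\<^sup>2 + B\<^sup>2 \<noteq> 0" using N(1,2) by auto
  then have "z \<noteq> 1" "z \<noteq> -1"
    using AB no_int_square_triple[of A B] no_int_square_triple[of B A] by auto
  ultimately have "z = 0" by blast
  then have "(cos \<theta>)\<^sup>2 = (sin \<theta>)\<^sup>2" using c s by simp
  then have "(tan \<theta>)\<^sup>2 = 1" using assms by (simp add: tan_def power_divide)
  then show ?thesis by (simp add: abs_square_eq_1)
qed

section \<open>The rotation angle of an oblique self-embedding\<close>

context carpet_self_embedding
begin

text \<open>All rotations of \<open>v\<close> by multiples of \<open>\<theta>\<close> are edge normals again, hence perpendicular to integer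
  vectors of bounded length. Here \<open>N\<close> is the product of the squared lengths of the integer vectors
  belonging to \<open>v\<close> and to its image.\<close>
lemma rotation_multiples_rational:
  assumes f: "f = (\<lambda>p. r *\<^sub>R rotation \<theta> p + a)" and v: "v \<noteq> 0" "v \<in> edge_normals K"
  shows "\<exists>A B N. int N = A\<^sup>2 + B\<^sup>2 \<and> N \<in> {1..(2 * n\<^sup>2)\<^sup>2} \<and>
      cos (real k * \<theta>) * of_int B = sin (real k * \<theta>) * of_int A"
proof -
  have "rotation (real k * \<theta>) v \<in> edge_normals K"
  proof (induction k)
    case 0
    then show ?case using v by (cases v) simp
  next
    case (Suc k)
    have "rotation (real (Suc k) * \<theta>) v = rotation \<theta> (rotation (real k * \<theta>) v)"
      by (simp add: rotation_rotation algebra_simps)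
    then show ?case using rotation_edge_normals[OF f Suc] by simp
  qed
  then obtain q1 q2 where q: "0 < q1\<^sup>2 + q2\<^sup>2" "q1\<^sup>2 + q2\<^sup>2 \<le> 2 * (int n)\<^sup>2"
    "rotation (real k * \<theta>) v \<bullet> (of_int q1, of_int q2) = 0" by (rule edge_normal_rational)
  obtain p1 p2 where p: "0 < p1\<^sup>2 + p2\<^sup>2" "p1\<^sup>2 + p2\<^sup>2 \<le> 2 * (int n)\<^sup>2" "v \<bullet> (of_int p1, of_int p2) = 0"
    using v(2) by (rule edge_normal_rational)
  define A B where "A = p1 * q1 + p2 * q2" and "B = p1 * q2 - p2 * q1"
  have AB: "A\<^sup>2 + B\<^sup>2 = (p1\<^sup>2 + p2\<^sup>2) * (q1\<^sup>2 + q2\<^sup>2)"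
    unfolding A_def B_def by algebra
  have pos: "0 < A\<^sup>2 + B\<^sup>2" unfolding AB using p q by simp
  have "A\<^sup>2 + B\<^sup>2 \<le> (2 * (int n)\<^sup>2) * (2 * (int n)\<^sup>2)"
    unfolding AB using p q by (intro mult_mono) auto
  also have "\<dots> = int ((2 * n\<^sup>2)\<^sup>2)" by (simp add: power2_eq_square)
  finally have "nat (A\<^sup>2 + B\<^sup>2) \<le> (2 * n\<^sup>2)\<^sup>2" by (simp only: nat_le_iff)
  then have "nat (A\<^sup>2 + B\<^sup>2) \<in> {1..(2 * n\<^sup>2)\<^sup>2}" "int (nat (A\<^sup>2 + B\<^sup>2)) = A\<^sup>2 + B\<^sup>2"
    using pos by auto
  moreover have "cos (real k * \<theta>) * of_int B = sin (real k * \<theta>) * of_int A"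
    using perpendicular_rotation[OF v(1) p(3) q(3)] by (simp add: A_def B_def)
  ultimately show ?thesis by blast
qed

end

lemma oblique_rotation:
  assumes "0 < r" "oblique_similitude (\<lambda>p. r *\<^sub>R rotation \<theta> p + a)"
  shows "cos \<theta> \<noteq> 0" "sin \<theta> \<noteq> 0"
proof -
  let ?f = "\<lambda>p. r *\<^sub>R rotation \<theta> p + a"
  define g where "g t = (r * cos \<theta> * t, r * sin \<theta> * t)" for t
  have par: "\<not> affine_parallel (?f ` x_axis) x_axis" "\<not> affine_parallel (?f ` x_axis) y_axis"
    using assms(2) unfolding oblique_similitude_def oblique_line_def by blast+
  have "x_axis = range (\<lambda>t. (t, 0))" unfolding x_axis_def by auto
  then have "(\<lambda>p. - a + p) ` ?f ` x_axis = (\<lambda>p. - a + ?f p) ` range (\<lambda>t. (t, 0))"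
    by (simp only: image_image)
  also have "\<dots> = range g" by (simp add: image_image g_def mult.assoc)
  finally have shift: "(\<lambda>p. - a + p) ` ?f ` x_axis = range g" .
  show "sin \<theta> \<noteq> 0"
  proof
    assume s: "sin \<theta> = 0"
    then have c: "cos \<theta> \<noteq> 0" using sin_zero_abs_cos_one by force
    have "g (x / (r * cos \<theta>)) = (x, 0)" for x using s c assms(1) by (simp add: g_def)
    then have "(x, 0) \<in> range g" for x by (metis rangeI)
    moreover have "range g \<subseteq> x_axis" using s by (auto simp: g_def x_axis_def)
    ultimately have "range g = x_axis" unfolding x_axis_def by auto
    then show False using par(1) shift unfolding affine_parallel_def by metis
  qed
  show "cos \<theta> \<noteq> 0"
  proof
    assume c: "cos \<theta> = 0"
    then have s: "sin \<theta> \<noteq> 0" using sin_zero_abs_cos_one by force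
    have "g (x / (r * sin \<theta>)) = (0, x)" for x using s c assms(1) by (simp add: g_def)
    then have "(0, x) \<in> range g" for x by (metis rangeI)
    moreover have "range g \<subseteq> y_axis" using c by (auto simp: g_def y_axis_def)
    ultimately have "range g = y_axis" unfolding y_axis_def by auto
    then show False using par(2) shift unfolding affine_parallel_def by metis
  qed
qed

theorem theorem1p6:
  fixes n :: nat and \<Lambda> :: "(nat \<times> nat) set" and K :: "(real \<times> real) set"
    and f :: "real \<times> real \<Rightarrow> real \<times> real"
    and r \<theta> :: real and a :: "real \<times> real"
  assumes "n \<ge> 2"
    and "\<Lambda> \<subseteq> {0..<n} \<times> {0..<n}"
    and "1 < card \<Lambda>" and "card \<Lambda> < n\<^sup>2"
    and "K = carpet n \<Lambda>"
    and "strong_separation n \<Lambda>"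
    and "0 < r"
    and "f = (\<lambda>p. r *\<^sub>R rotation \<theta> p + a)"
    and "oblique_similitude f"
    and "f ` K \<subseteq> K"
  shows "\<bar>tan \<theta>\<bar> = 1"
proof -
  have "dist (f p) (f q) = r * dist p q" for p q
  proof -
    have "f p - f q = r *\<^sub>R rotation \<theta> (p - q)"
      by (simp add: assms(8) linear_diff[OF linear_rotation] scaleR_diff_right)
    then show ?thesis
      using assms(7) by (simp add: dist_norm norm_eq_sqrt_inner[of "rotation \<theta> _"] inner_rotation
          flip: norm_eq_sqrt_inner)
  qed
  then interpret carpet_self_embedding n \<Lambda> r f
    using assms by unfold_locales (auto simp: similitude_def)
  obtain d e where de: "d \<in> \<Lambda>" "e \<in> \<Lambda>" "d \<noteq> e"
    using assms(3) by (metis card_le_Suc0_iff_eq finite_digits not_le One_nat_def)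
  then have "digit d \<in> digit ` \<Lambda>" "digit e \<in> digit ` \<Lambda>" "digit d \<noteq> digit e"
    unfolding digit_inject by blast+
  then obtain v where v: "v \<noteq> 0" "v \<in> edge_normals (carpet n \<Lambda>)"
    using edge_normal_exists[of "digit ` \<Lambda>"] finite_digits unfolding edge_normals_carpet by blast
  show ?thesis
  proof (rule tan_one_if_rational_multiples)
    show "\<exists>A B N. int N = A\<^sup>2 + B\<^sup>2 \<and> N \<in> {1..(2 * n\<^sup>2)\<^sup>2} \<and>
      cos (real k * \<theta>) * of_int B = sin (real k * \<theta>) * of_int A" for k
      by (rule rotation_multiples_rational[OF assms(8) v])
    show "cos \<theta> \<noteq> 0" "sin \<theta> \<noteq> 0"
      using oblique_rotation[OF assms(7)] assms(9) unfolding assms(8) by blast+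
  qed
qed

end
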